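(* Let $x,y\in\mathbb{R}$ with $x<y$. Let $a_1,a_2,a_3,\alpha_1,\alpha_2,\alpha_3\in(0,1)$ satisfy $a_1+a_2+a_3=1$ and $\alpha_1>\alpha_2>\alpha_3$. Then the inequality $$\sum_{i=1}^3 a_i f(\alpha_i x+(1-\alpha_i)y)\leq \frac{1}{y-x}\int_x^y f(t)\,dt$$ is satisfied by all convex functions $f:[x,y]\to\mathbb{R}$ if and only if $$\sum_{i=1}^3 a_i(1-\alpha_i)=\frac12$$ and at least one of the following conditions is satisfied: (i) $a_1\leq 1-\alpha_1$ and $a_1+a_2\geq 1-\alpha_3$; (ii) $a_1\geq 1-\alpha_2$ and $a_1+a_2\geq 1-\alpha_3$; (iii) $a_1\leq 1-\alpha_1$ and $a_1+a_2\leq 1-\alpha_2$; (iv) $a_1\leq 1-\alpha_1$, $a_1+a_2\in(1-\alpha_2,1-\alpha_3)$ and $2\alpha_3\geq a_3$; (v) $a_1\geq 1-\alpha_2$, $a_1+a_2<1-\alpha_3$ and $2\alpha_3\geq a_3$; (vi) $a_1>1-\alpha_1$, $a_1+a_2\leq 1-\alpha_2$ and $1-\alpha_1\geq\frac{a_1}{2}$; (vii) $a_1\in(1-\alpha_1,1-\alpha_2)$, $a_1+a_2\geq 1-\alpha_3$ and $1-\alpha_1\geq\frac{a_1}{2}$; (viii) $a_1\in(1-\alpha_1,1-\alpha_2)$, $a_1+a_2\in(1-\alpha_2,1-\alpha_3)$, $1-\alpha_1\geq\frac{a_1}{2}$ and $2a_1(1-\alpha_1)+2a_2(1-\alpha_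2)\geq(a_1+a_2)^2$.
   Context: All intervals $(p,q)$ are open intervals of real numbers. The numbers $a_i,\alpha_i$ and the endpoints $x<y$ are fixed, and the quantification "for all convex functions" is over all convex $f:[x,y]\to\mathbb{R}$. *)

theory Defs
  imports "HOL-Analysis.Analysis"
begin

end

theory Submission
  imports Defs
begin

text \<open>
  Write \<open>t i = 1 - \<alpha> i\<close>, so that the left-hand side is the integral of \<open>f\<close> against the
  measure with masses \<open>a i\<close> at the points \<open>x + t i * (y - x)\<close>. The inequality for all convex \<open>f\<close>
  says that this measure precedes the uniform distribution on \<open>{x..y}\<close> in the convex order.

  Convex order can be tested on the affine functions and the hinges \<open>s \<mapsto> max 0 (u - s)\<close>
  (\<open>atoms_below_uniform_iff\<close>). Necessity holds because these functions are convex. For sufficiency,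
  the left-hand side sees \<open>f\<close> only at finitely many interior points, and the maximum of
  supporting lines of \<open>f\<close> at these points is a minorant of \<open>f\<close> that agrees with \<open>f\<close> there and is an
  affine function plus a nonnegative combination of hinges (\<open>convex_hinge_minorant\<close>). Replacing
  \<open>f\<close> by this minorant keeps the left-hand side and does not raise the integral.

  After rescaling to the unit interval, the affine functions give the condition on the mean, and
  the hinges say that the piecewise linear function \<open>\<Sum> a i * max 0 (s - t i)\<close> stays below the
  parabola \<open>s\<^sup>2 / 2\<close> on \<open>{0..1}\<close>. To the left of \<open>t 1\<close> and to the right of \<open>t 3\<close> this is automatic
  (on the right because of the mean condition). On \<open>{t 1..t 2}\<close> and \<open>{t 2..t 3}\<close> the difference is a
  concave quadratic in \<open>s\<close> with vertex \<open>a 1\<close>, respectively \<open>a 1 + a 2\<close>, so the vertex value matters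
  exactly when the vertex lies inside the piece (\<open>three_hinges_below_parabola_iff\<close>). The eight
  alternatives enumerate the possible positions of the two vertices.
\<close>

section \<open>Supporting lines and integrability of convex functions\<close>

lemma convex_on_supporting_line:
  fixes f :: "real \<Rightarrow> real"
  assumes "convex_on {x..y} f" "t \<in> {x<..<y}"
  obtains m where "\<And>s. s \<in> {x..y} \<Longrightarrow> f t + m * (s - t) \<le> f s"
  using convex_le_Inf_differential[OF assms(1), of t] assms(2) that
  by (auto simp: interior_atLeastAtMost_real)

text \<open>
  A convex function on a closed interval may jump at the endpoints, so continuity is only
  available inside. Boundedness comes from the chord above and a supporting line below.
\<close>

lemma convex_on_integrable:
  fixes f :: "real \<Rightarrow> real"
  assumes "convex_on {x..y} f" "x < y"
  shows "f integrable_on {x..y}"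
proof -
  define c where "c = (x + y) / 2"
  have c: "c \<in> {x<..<y}"
    using assms(2) by (auto simp: c_def)
  obtain m where m: "\<And>s. s \<in> {x..y} \<Longrightarrow> f c + m * (s - c) \<le> f s"
    using convex_on_supporting_line[OF assms(1) c] by blast
  have "continuous_on {x<..<y} f"
    by (intro convex_on_continuous convex_on_subset[OF assms(1)]) auto
  then have meas: "f \<in> borel_measurable (lebesgue_on {x<..<y})"
    by (intro continuous_imp_measurable_on_sets_lebesgue) auto
  have bound: "norm (f s) \<le> \<bar>f x\<bar> + \<bar>f y\<bar> + \<bar>f c\<bar> + \<bar>m\<bar> * (y - x)" if s: "s \<in> {x<..<y}" for s
  proof -
    have "f s \<le> max (f x) (f y)"
      using convex_on_le_max[OF assms(1)] s by auto
    moreover have "\<bar>m * (s - c)\<bar> \<le> \<bar>m\<bar> * (y - x)"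
      unfolding abs_mult using s c by (intro mult_left_mono) auto
    moreover have "f c + m * (s - c) \<le> f s"
      using m s by auto
    moreover have "0 \<le> \<bar>m\<bar> * (y - x)"
      using assms(2) by auto
    ultimately show ?thesis
      unfolding real_norm_def by linarith
  qed
  have "f integrable_on {x<..<y}"
    by (rule measurable_bounded_by_integrable_imp_integrable[OF meas _ bound])
       (auto simp: integrable_on_open_interval_real)
  then show ?thesis
    by (simp add: integrable_on_open_interval_real)
qed

section \<open>Hinge functions and piecewise linear minorants\<close>

text \<open>
  These are the convex piecewise linear functions whose kinks lie in \<open>{x..y}\<close>. The inductive form turns a proof that an
  integral inequality passes from hinges to all of them into a rule induction.
\<close>

inductive_set hinge_cone :: "real \<Rightarrow> real \<Rightarrow> (real \<Rightarrow> real) set" for x y where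
  affine: "(\<lambda>s. c + d * s) \<in> hinge_cone x y"
| add_hinge: "h \<in> hinge_cone x y \<Longrightarrow> 0 \<le> k \<Longrightarrow> u \<in> {x..y} \<Longrightarrow>
    (\<lambda>s. h s + k * max 0 (u - s)) \<in> hinge_cone x y"

lemma convex_on_hinge:
  fixes u :: real
  shows "convex_on UNIV (\<lambda>s. max 0 (u - s))"
proof (rule convex_on_linorderI)
  fix t p q :: real
  assume t: "0 < t" "t < 1"
  have "u - ((1 - t) * p + t * q) = (1 - t) * (u - p) + t * (u - q)"
    by (simp add: algebra_simps)
  also have "\<dots> \<le> (1 - t) * max 0 (u - p) + t * max 0 (u - q)"
    using t by (intro add_mono mult_left_mono) auto
  finally show "max 0 (u - ((1 - t) *\<^sub>R p + t *\<^sub>R q)) \<le> (1 - t) * max 0 (u - p) + t * max 0 (u - q)"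
    using t by auto
qed auto

lemma has_integral_hinge:
  fixes u :: real
  assumes "u \<in> {x..y}"
  shows "((\<lambda>s. max 0 (u - s)) has_integral (u - x)\<^sup>2 / 2) {x..y}"
proof -
  have "((\<lambda>s. u - s) has_integral (u * u - u\<^sup>2 / 2 - (u * x - x\<^sup>2 / 2))) {x..u}"
    using assms by (intro fundamental_theorem_of_calculus)
      (auto intro!: derivative_eq_intros simp flip: has_real_derivative_iff_has_vector_derivative)
  then have left: "((\<lambda>s. max 0 (u - s)) has_integral (u * u - u\<^sup>2 / 2 - (u * x - x\<^sup>2 / 2))) {x..u}"
    by (rule has_integral_eq[rotated]) auto
  have right: "((\<lambda>s. max 0 (u - s)) has_integral 0) {u..y}"
    by (rule has_integral_is_0) auto
  have "((\<lambda>s. max 0 (u - s)) has_integral (u * u - u\<^sup>2 / 2 - (u * x - x\<^sup>2 / 2) + 0)) {x..y}"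
    using assms by (intro has_integral_combine[OF _ _ left right]) auto
  also have "u * u - u\<^sup>2 / 2 - (u * x - x\<^sup>2 / 2) + 0 = (u - x)\<^sup>2 / 2"
    by (simp add: power2_eq_square field_simps)
  finally show ?thesis .
qed

lemma has_integral_affine:
  fixes c d :: real
  assumes "x \<le> y"
  shows "((\<lambda>s. c + d * s) has_integral (y - x) * (c + d * ((x + y) / 2))) {x..y}"
proof -
  have "((\<lambda>s. c + d * s) has_integral (c * y + d * (y\<^sup>2 / 2) - (c * x + d * (x\<^sup>2 / 2)))) {x..y}"
    using assms by (intro fundamental_theorem_of_calculus)
      (auto intro!: derivative_eq_intros simp flip: has_real_derivative_iff_has_vector_derivative)
  also have "c * y + d * (y\<^sup>2 / 2) - (c * x + d * (x\<^sup>2 / 2)) = (y - x) * (c + d * ((x + y) / 2))"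
    by (simp add: power2_eq_square field_simps)
  finally show ?thesis .
qed

text \<open>
  The points are added from right to left. To the left of the leftmost point so far, the
  minorant follows the supporting line there; a hinge at the point where this line meets the
  supporting line of the new point bends it onto the latter. The last two
  conjuncts are the invariant that makes this step possible.
\<close>

lemma convex_hinge_minorant_with_end:
  fixes f :: "real \<Rightarrow> real"
  assumes f: "convex_on {x..y} f" and "finite T" "T \<noteq> {}" "T \<subseteq> {x<..<y}"
  shows "\<exists>h\<in>hinge_cone x y. \<exists>m. (\<forall>s\<in>{x..y}. h s \<le> f s) \<and> (\<forall>t\<in>T. h t = f t) \<and>
           (\<forall>s\<in>{x..y}. f (Min T) + m * (s - Min T) \<le> f s) \<and>
           (\<forall>s\<le>Min T. h s = f (Min T) + m * (s - Min T))"
  using assms(2-4)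
proof (induction T rule: finite_linorder_min_induct)
  case empty
  then show ?case by simp
next
  case (insert t T)
  have t: "t \<in> {x<..<y}" and T: "T \<subseteq> {x<..<y}"
    using insert.prems by simp_all
  obtain m where m: "\<And>s. s \<in> {x..y} \<Longrightarrow> f t + m * (s - t) \<le> f s"
    using convex_on_supporting_line[OF f t] by blast
  show ?case
  proof (cases "T = {}")
    case True
    have "(\<lambda>s. (f t - m * t) + m * s) \<in> hinge_cone x y"
      by (rule hinge_cone.affine)
    then show ?thesis
      using m True by (intro bexI exI[of _ m]) (auto simp: algebra_simps)
  next
    case False
    define r where "r = Min T"
    have r: "r \<in> T"
      using False insert.hyps by (simp add: r_def)
    have tr: "t < r" and ryx: "r \<in> {x<..<y}"
      using r insert by auto
    have Min: "Min (insert t T) = t"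
      by (rule Min_eqI) (use insert.hyps in \<open>auto intro: less_imp_le\<close>)
    obtain h n where h: "h \<in> hinge_cone x y" and IH:
        "\<forall>s\<in>{x..y}. h s \<le> f s" "\<forall>s\<in>T. h s = f s"
        "\<forall>s\<in>{x..y}. f r + n * (s - r) \<le> f s" "\<forall>s\<le>r. h s = f r + n * (s - r)"
      using insert.IH[OF False T] unfolding r_def[symmetric] by blast
    note hf = IH(1)[THEN bspec] and hT = IH(2)[THEN bspec]
      and n = IH(3)[THEN bspec] and hn = IH(4)[rule_format]
    have above: "f t + m * (r - t) \<le> f r" and below: "f r + n * (t - r) \<le> f t"
      using m[of r] n[of t] t ryx by auto
    have "(m - n) * (r - t) \<le> 0"
      using above below by (simp add: algebra_simps)
    then have mn: "m \<le> n"
      using tr by (simp add: mult_le_0_iff)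
    obtain u where u: "t \<le> u" "u \<le> r" and meet: "f r + n * (u - r) = f t + m * (u - t)"
    proof -
      let ?D = "\<lambda>u. (f r + n * (u - r)) - (f t + m * (u - t))"
      have "\<exists>u. t \<le> u \<and> u \<le> r \<and> ?D u = 0"
        using above below tr by (intro IVT') (auto intro!: continuous_intros)
      then show thesis
        using that by auto
    qed
    define g where "g s = h s + (n - m) * max 0 (u - s)" for s
    have "g \<in> hinge_cone x y"
      unfolding g_def using h mn u t ryx by (intro hinge_cone.add_hinge) auto
    moreover have g_left: "g s = f t + m * (s - t)" if "s \<le> u" for s
      using that hn[of s] u meet by (simp add: g_def algebra_simps)
    moreover have g_right: "g s = h s" if "u \<le> s" for s
      using that by (simp add: g_def)
    moreover have "g s \<le> f s" if "s \<in> {x..y}" for s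
      using g_left[of s] g_right[of s] m[OF that] hf[OF that] by (cases "s \<le> u") auto
    moreover have "g s = f s" if "s \<in> insert t T" for s
    proof (cases "s = t")
      case True
      then show ?thesis using g_left[of t] u by simp
    next
      case False
      then have "s \<in> T" "r \<le> s"
        using that insert.hyps by (auto simp: r_def)
      then show ?thesis using g_right[of s] hT[of s] u by simp
    qed
    ultimately show ?thesis
      unfolding Min using m u by (intro bexI[of _ g] exI[of _ m]) auto
  qed
qed

lemma convex_hinge_minorant:
  fixes f :: "real \<Rightarrow> real"
  assumes "convex_on {x..y} f" "finite T" "T \<subseteq> {x<..<y}" "T \<noteq> {}"
  obtains h where "h \<in> hinge_cone x y" "\<And>s. s \<in> {x..y} \<Longrightarrow> h s \<le> f s" "\<And>t. t \<in> T \<Longrightarrow> h t = f t"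
  using convex_hinge_minorant_with_end[OF assms(1,2,4,3)] by blast

section \<open>Finitely many atoms below the uniform distribution in convex order\<close>

theorem atoms_below_uniform_iff:
  fixes a p :: "'i \<Rightarrow> real"
  assumes "x < y" and I: "finite I" and p: "\<And>i. i \<in> I \<Longrightarrow> p i \<in> {x<..<y}"
    and mass: "(\<Sum>i\<in>I. a i) = 1"
  shows "(\<forall>f. convex_on {x..y} f \<longrightarrow> (\<Sum>i\<in>I. a i * f (p i)) \<le> 1 / (y - x) * integral {x..y} f) \<longleftrightarrow>
         (\<Sum>i\<in>I. a i * p i) = (x + y) / 2 \<and>
         (\<forall>u\<in>{x..y}. (\<Sum>i\<in>I. a i * max 0 (u - p i)) \<le> (u - x)\<^sup>2 / (2 * (y - x)))"
    (is "?order \<longleftrightarrow> ?mean \<and> ?hinges")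
proof (intro iffI conjI)
  assume order: ?order
  have id: "integral {x..y} (\<lambda>s. s) = (y - x) * ((x + y) / 2)"
    using has_integral_affine[of x y 0 1] \<open>x < y\<close> by (intro integral_unique) simp
  have "convex_on {x..y} (\<lambda>s::real. s)" "convex_on {x..y} (\<lambda>s::real. - s)"
    using convex_on_ident concave_on_ident by (auto simp: concave_on_def)
  from this[THEN order[rule_format]] show ?mean
    using \<open>x < y\<close> by (simp add: id sum_negf)
  show ?hinges
  proof
    fix u assume u: "u \<in> {x..y}"
    have "convex_on {x..y} (\<lambda>s. max 0 (u - s))"
      by (rule convex_on_subset[OF convex_on_hinge]) auto
    from order[rule_format, OF this]
    show "(\<Sum>i\<in>I. a i * max 0 (u - p i)) \<le> (u - x)\<^sup>2 / (2 * (y - x))"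
      by (simp add: integral_unique[OF has_integral_hinge[OF u]] mult.commute)
  qed
next
  assume cond: "?mean \<and> ?hinges"
  \<comment> \<open>The integral value is carried along so that integrability of the hinge function is part of
     the induction.\<close>
  have test: "\<exists>J. (h has_integral J) {x..y} \<and> (y - x) * (\<Sum>i\<in>I. a i * h (p i)) \<le> J"
    if "h \<in> hinge_cone x y" for h
    using that
  proof induction
    case (affine c d)
    have "(\<Sum>i\<in>I. a i * (c + d * p i)) = c * (\<Sum>i\<in>I. a i) + d * (\<Sum>i\<in>I. a i * p i)"
      by (simp add: sum_distrib_left sum.distrib algebra_simps)
    then have "(\<Sum>i\<in>I. a i * (c + d * p i)) = c + d * ((x + y) / 2)"
      using cond mass by simp
    then show ?case
      using has_integral_affine[of x y c d] \<open>x < y\<close> by (intro exI conjI) auto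
  next
    case (add_hinge h k u)
    then obtain J where J: "(h has_integral J) {x..y}" "(y - x) * (\<Sum>i\<in>I. a i * h (p i)) \<le> J"
      by blast
    let ?H = "\<Sum>i\<in>I. a i * max 0 (u - p i)"
    have "?H \<le> (u - x)\<^sup>2 / (2 * (y - x))"
      using cond add_hinge by blast
    then have "(y - x) * ?H \<le> (u - x)\<^sup>2 / 2"
      using \<open>x < y\<close> by (simp add: field_simps)
    then have "k * ((y - x) * ?H) \<le> k * ((u - x)\<^sup>2 / 2)"
      using add_hinge by (intro mult_left_mono)
    moreover have "(y - x) * (\<Sum>i\<in>I. a i * (h (p i) + k * max 0 (u - p i))) =
        (y - x) * (\<Sum>i\<in>I. a i * h (p i)) + k * ((y - x) * ?H)"
      by (simp add: sum_distrib_left sum.distrib algebra_simps)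
    moreover have "((\<lambda>s. h s + k * max 0 (u - s)) has_integral J + k * ((u - x)\<^sup>2 / 2)) {x..y}"
      using add_hinge by (intro has_integral_add J(1) has_integral_mult_right has_integral_hinge)
    ultimately show ?case
      using J(2) by (intro exI conjI) auto
  qed
  show ?order
  proof (intro allI impI)
    fix f :: "real \<Rightarrow> real"
    assume f: "convex_on {x..y} f"
    have "I \<noteq> {}"
      using mass by auto
    then obtain h where h: "h \<in> hinge_cone x y" and hf: "\<And>s. s \<in> {x..y} \<Longrightarrow> h s \<le> f s"
      and hp: "\<And>t. t \<in> p ` I \<Longrightarrow> h t = f t"
      using convex_hinge_minorant[OF f, of "p ` I"] I p by blast
    obtain J where J: "(h has_integral J) {x..y}" "(y - x) * (\<Sum>i\<in>I. a i * h (p i)) \<le> J"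
      using test[OF h] by blast
    have "(y - x) * (\<Sum>i\<in>I. a i * f (p i)) \<le> J"
      using J(2) hp by simp
    also have "J \<le> integral {x..y} f"
      using convex_on_integrable[OF f \<open>x < y\<close>]
      by (intro has_integral_le[OF J(1) integrable_integral] hf) auto
    finally show "(\<Sum>i\<in>I. a i * f (p i)) \<le> 1 / (y - x) * integral {x..y} f"
      using \<open>x < y\<close> by (simp add: field_simps)
  qed
qed

text \<open>Convex order is invariant under the affine map from the unit interval onto \<open>{x..y}\<close>.\<close>

corollary scaled_atoms_below_uniform_iff:
  fixes a t :: "'i \<Rightarrow> real"
  assumes "x < y" and "finite I" and t: "\<And>i. i \<in> I \<Longrightarrow> t i \<in> {0<..<1}"
    and mass: "(\<Sum>i\<in>I. a i) = 1"
  shows "(\<forall>f. convex_on {x..y} f \<longrightarrow>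
            (\<Sum>i\<in>I. a i * f (x + t i * (y - x))) \<le> 1 / (y - x) * integral {x..y} f) \<longleftrightarrow>
         (\<Sum>i\<in>I. a i * t i) = 1 / 2 \<and>
         (\<forall>s\<in>{0..1}. (\<Sum>i\<in>I. a i * max 0 (s - t i)) \<le> s\<^sup>2 / 2)"
proof -
  have p: "x + t i * (y - x) \<in> {x<..<y}" if "i \<in> I" for i
  proof -
    have "0 < t i * (y - x)" "t i * (y - x) < 1 * (y - x)"
      using t[OF that] \<open>x < y\<close> by (auto intro!: mult_strict_right_mono simp del: mult_1)
    then show ?thesis by auto
  qed
  have "(\<Sum>i\<in>I. a i * (x + t i * (y - x))) = x * (\<Sum>i\<in>I. a i) + (y - x) * (\<Sum>i\<in>I. a i * t i)"
    by (simp add: sum_distrib_left sum.distrib sum_subtractf algebra_simps)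
  moreover have midpoint: "(x + y) / 2 = x + (y - x) * (1 / 2)"
    by (simp add: field_simps)
  ultimately have mean: "(\<Sum>i\<in>I. a i * (x + t i * (y - x))) = (x + y) / 2 \<longleftrightarrow> (\<Sum>i\<in>I. a i * t i) = 1 / 2"
    unfolding midpoint using mass \<open>x < y\<close> by simp
  have image: "{x..y} = (\<lambda>s. x + s * (y - x)) ` {0..1}"
    using image_affinity_atLeastAtMost[of "y - x" x 0 1] \<open>x < y\<close> by (simp add: algebra_simps)
  have hinge: "(\<Sum>i\<in>I. a i * max 0 (x + s * (y - x) - (x + t i * (y - x)))) \<le>
        (x + s * (y - x) - x)\<^sup>2 / (2 * (y - x)) \<longleftrightarrow> (\<Sum>i\<in>I. a i * max 0 (s - t i)) \<le> s\<^sup>2 / 2" for s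
  proof -
    have "max 0 (x + s * (y - x) - (x + t i * (y - x))) = (y - x) * max 0 (s - t i)" for i
      using \<open>x < y\<close> by (simp add: max_mult_distrib_left algebra_simps)
    then have "(\<Sum>i\<in>I. a i * max 0 (x + s * (y - x) - (x + t i * (y - x)))) =
        (y - x) * (\<Sum>i\<in>I. a i * max 0 (s - t i))"
      by (simp add: sum_distrib_left mult.left_commute)
    moreover have "(x + s * (y - x) - x)\<^sup>2 / (2 * (y - x)) = (y - x) * (s\<^sup>2 / 2)"
      using \<open>x < y\<close> by (simp add: power2_eq_square del: right_diff_distrib_numeral)
    ultimately show ?thesis
      using \<open>x < y\<close> by (simp only: mult_le_cancel_left_pos diff_gt_0_iff_gt)
  qed
  have "(\<forall>u\<in>{x..y}. (\<Sum>i\<in>I. a i * max 0 (u - (x + t i * (y - x)))) \<le> (u - x)\<^sup>2 / (2 * (y - x))) \<longleftrightarrow>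
      (\<forall>s\<in>{0..1}. (\<Sum>i\<in>I. a i * max 0 (s - t i)) \<le> s\<^sup>2 / 2)"
    by (simp only: image ball_simps hinge)
  then show ?thesis
    using atoms_below_uniform_iff[OF assms(1,2) p mass] mean by simp
qed

section \<open>Three hinges below a parabola\<close>

text \<open>
  \<open>A * s - B - s\<^sup>2 / 2\<close> is concave in \<open>s\<close> with vertex \<open>A\<close>, so its maximum over \<open>{p..q}\<close> is
  attained at the point of \<open>{p..q}\<close> closest to \<open>A\<close>.
\<close>

lemma line_below_parabola:
  fixes A B p q s :: real
  assumes "s \<in> {p..q}"
    and "A \<le> p \<Longrightarrow> A * p - B \<le> p\<^sup>2 / 2"
    and "q \<le> A \<Longrightarrow> A * q - B \<le> q\<^sup>2 / 2"
    and "p < A \<Longrightarrow> A < q \<Longrightarrow> A\<^sup>2 \<le> 2 * B"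
  shows "A * s - B \<le> s\<^sup>2 / 2"
proof -
  have less: "A * s - B \<le> s\<^sup>2 / 2" if "A * r - B \<le> r\<^sup>2 / 2" "(s - r) * (2 * A - s - r) \<le> 0" for r
    using that by (simp add: power2_eq_square algebra_simps)
  consider "A \<le> p" | "q \<le> A" | "p < A" "A < q"
    by linarith
  then show ?thesis
  proof cases
    case 1
    then show ?thesis
      using assms by (intro less[of p]) (auto simp: mult_le_0_iff)
  next
    case 2
    then show ?thesis
      using assms by (intro less[of q]) (auto simp: mult_le_0_iff)
  next
    case 3
    then have "A\<^sup>2 \<le> 2 * B"
      using assms by simp
    moreover have "0 \<le> (A - s)\<^sup>2"
      by simp
    ultimately show ?thesis
      by (simp add: power2_eq_square algebra_simps)
  qed
qed

lemma three_hinges_below_parabola_iff: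
  fixes a1 a2 a3 t1 t2 t3 :: real
  assumes t: "0 < t1" "t1 < t2" "t2 < t3" "t3 < 1"
    and a: "0 < a1" "0 < a2" "a1 + a2 + a3 = 1"
    and mean: "a1 * t1 + a2 * t2 + a3 * t3 = 1 / 2"
  shows "(\<forall>s\<in>{0..1}. a1 * max 0 (s - t1) + a2 * max 0 (s - t2) + a3 * max 0 (s - t3) \<le> s\<^sup>2 / 2) \<longleftrightarrow>
         (t1 < a1 \<and> a1 < t2 \<longrightarrow> a1 \<le> 2 * t1) \<and>
         (t2 < a1 + a2 \<and> a1 + a2 < t3 \<longrightarrow> (a1 + a2)\<^sup>2 \<le> 2 * a1 * t1 + 2 * a2 * t2)"
    (is "(\<forall>s\<in>{0..1}. ?G s \<le> _) \<longleftrightarrow> ?vertex1 \<and> ?vertex2")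
proof (intro iffI conjI)
  assume G: "\<forall>s\<in>{0..1}. ?G s \<le> s\<^sup>2 / 2"
  show ?vertex1
  proof
    assume "t1 < a1 \<and> a1 < t2"
    then have "a1 * (a1 - t1) \<le> a1\<^sup>2 / 2"
      using G[rule_format, of a1] t a by auto
    then have "a1 * a1 \<le> a1 * (2 * t1)"
      by (simp add: power2_eq_square algebra_simps)
    then show "a1 \<le> 2 * t1"
      using a by (simp only: mult_le_cancel_left_pos)
  qed
  show ?vertex2
  proof
    assume "t2 < a1 + a2 \<and> a1 + a2 < t3"
    then have "a1 * (a1 + a2 - t1) + a2 * (a1 + a2 - t2) \<le> (a1 + a2)\<^sup>2 / 2"
      using G[rule_format, of "a1 + a2"] t a by auto
    then show "(a1 + a2)\<^sup>2 \<le> 2 * a1 * t1 + 2 * a2 * t2"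
      by (simp add: power2_eq_square algebra_simps)
  qed
next
  assume vertices: "?vertex1 \<and> ?vertex2"
  let ?B = "a1 * t1 + a2 * t2"
  have tail: "s - 1 / 2 \<le> s\<^sup>2 / 2" for s :: real
    using zero_le_power2[of "s - 1"] by (simp add: power2_eq_square algebra_simps)
  have piece3: "a1 * (s - t1) + a2 * (s - t2) + a3 * (s - t3) \<le> s\<^sup>2 / 2" for s
  proof -
    have "a1 * (s - t1) + a2 * (s - t2) + a3 * (s - t3) =
        (a1 + a2 + a3) * s - (a1 * t1 + a2 * t2 + a3 * t3)"
      by (simp add: algebra_simps)
    then show ?thesis
      using tail[of s] a(3) mean by simp
  qed
  have at_t3: "(a1 + a2) * t3 - ?B \<le> t3\<^sup>2 / 2"
    using piece3[of t3] by (simp add: algebra_simps)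
  have vertex1: "a1\<^sup>2 \<le> 2 * (a1 * t1)" if "t1 < a1" "a1 < t2"
    using vertices that a mult_left_mono[of a1 "2 * t1" a1] by (simp add: power2_eq_square)
  have vertex2: "(a1 + a2)\<^sup>2 \<le> 2 * ?B" if "t2 < a1 + a2" "a1 + a2 < t3"
    using vertices that by (simp add: algebra_simps)
  \<comment> \<open>If the first vertex is left of \<open>t2\<close>, the first piece controls the breakpoint \<open>t2\<close>;
     otherwise the second vertex is right of \<open>t2\<close>, and the second piece does.\<close>
  have at_t2: "a1 * t2 - a1 * t1 \<le> t2\<^sup>2 / 2"
  proof (cases "a1 < t2")
    case True
    show ?thesis
      by (rule line_below_parabola[of t2 t1 t2, OF _ _ _ vertex1]) (use t True in auto)
  next
    case False
    have "(a1 + a2) * t2 - ?B \<le> t2\<^sup>2 / 2"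
      by (rule line_below_parabola[of t2 t2 t3, OF _ _ at_t3 vertex2]) (use False t a in auto)
    then show ?thesis
      by (simp add: algebra_simps)
  qed
  show "\<forall>s\<in>{0..1}. ?G s \<le> s\<^sup>2 / 2"
  proof
    fix s :: real
    consider "s \<le> t1" | "s \<in> {t1..t2}" | "s \<in> {t2..t3}" | "t3 \<le> s"
      by fastforce
    then show "?G s \<le> s\<^sup>2 / 2"
    proof cases
      case 1
      then show ?thesis using t by simp
    next
      case 2
      then have "a1 * s - a1 * t1 \<le> s\<^sup>2 / 2"
        by (rule line_below_parabola[of s t1 t2, OF _ _ at_t2 vertex1]) auto
      then show ?thesis
        using 2 t by (simp add: algebra_simps)
    next
      case 3
      have at_t2': "(a1 + a2) * t2 - ?B \<le> t2\<^sup>2 / 2"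
        using at_t2 by (simp add: algebra_simps)
      have "(a1 + a2) * s - ?B \<le> s\<^sup>2 / 2"
        by (rule line_below_parabola[OF 3 at_t2' at_t3 vertex2])
      then show ?thesis
        using 3 t by (simp add: algebra_simps)
    next
      case 4
      then show ?thesis
        using piece3[of s] t by simp
    qed
  qed
qed

text \<open>
  Each vertex lies left of, inside or right of its piece. Of the nine combined positions,
  \<open>t2 \<le> v\<close> with \<open>w \<le> t2\<close> is impossible because \<open>v < w\<close>; the alternatives are the other eight,
  each with the conditions of those vertices that lie inside.
\<close>

lemma vertex_conditions_iff_alternatives:
  fixes v w t1 t2 t3 :: real
  assumes "t1 < t2" "t2 < t3" "v < w"
  shows "(t1 < v \<and> v < t2 \<longrightarrow> P) \<and> (t2 < w \<and> w < t3 \<longrightarrow> Q) \<longleftrightarrow>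
         (v \<le> t1 \<and> w \<ge> t3) \<or>
         (v \<ge> t2 \<and> w \<ge> t3) \<or>
         (v \<le> t1 \<and> w \<le> t2) \<or>
         (v \<le> t1 \<and> w \<in> {t2<..<t3} \<and> Q) \<or>
         (v \<ge> t2 \<and> w < t3 \<and> Q) \<or>
         (v > t1 \<and> w \<le> t2 \<and> P) \<or>
         (v \<in> {t1<..<t2} \<and> w \<ge> t3 \<and> P) \<or>
         (v \<in> {t1<..<t2} \<and> w \<in> {t2<..<t3} \<and> P \<and> Q)"
  using assms by (cases "v \<le> t1"; cases "v < t2"; cases "w \<le> t2"; cases "w < t3") auto

section \<open>The Hermite-Hadamard type inequality with three nodes\<close>

theorem theorem2:
  fixes x y :: real and a \<alpha> :: "nat \<Rightarrow> real"
  assumes "x < y"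
    and "\<forall>i\<in>{1..3}. a i \<in> {0<..<1}"
    and "\<forall>i\<in>{1..3}. \<alpha> i \<in> {0<..<1}"
    and "a 1 + a 2 + a 3 = 1"
    and "\<alpha> 1 > \<alpha> 2" and "\<alpha> 2 > \<alpha> 3"
  shows "(\<forall>f :: real \<Rightarrow> real. convex_on {x..y} f \<longrightarrow>
            (\<Sum>i=1..3. a i * f (\<alpha> i * x + (1 - \<alpha> i) * y))
              \<le> 1 / (y - x) * integral {x..y} f)
         \<longleftrightarrow>
         (\<Sum>i=1..3. a i * (1 - \<alpha> i)) = 1 / 2 \<and>
         ((a 1 \<le> 1 - \<alpha> 1 \<and> a 1 + a 2 \<ge> 1 - \<alpha> 3) \<or>
          (a 1 \<ge> 1 - \<alpha> 2 \<and> a 1 + a 2 \<ge> 1 - \<alpha> 3) \<or>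
          (a 1 \<le> 1 - \<alpha> 1 \<and> a 1 + a 2 \<le> 1 - \<alpha> 2) \<or>
          (a 1 \<le> 1 - \<alpha> 1 \<and> a 1 + a 2 \<in> {1 - \<alpha> 2<..<1 - \<alpha> 3} \<and> 2 * \<alpha> 3 \<ge> a 3) \<or>
          (a 1 \<ge> 1 - \<alpha> 2 \<and> a 1 + a 2 < 1 - \<alpha> 3 \<and> 2 * \<alpha> 3 \<ge> a 3) \<or>
          (a 1 > 1 - \<alpha> 1 \<and> a 1 + a 2 \<le> 1 - \<alpha> 2 \<and> 1 - \<alpha> 1 \<ge> a 1 / 2) \<or>
          (a 1 \<in> {1 - \<alpha> 1<..<1 - \<alpha> 2} \<and> a 1 + a 2 \<ge> 1 - \<alpha> 3 \<and> 1 - \<alpha> 1 \<ge> a 1 / 2) \<or>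
          (a 1 \<in> {1 - \<alpha> 1<..<1 - \<alpha> 2} \<and> a 1 + a 2 \<in> {1 - \<alpha> 2<..<1 - \<alpha> 3} \<and>
             1 - \<alpha> 1 \<ge> a 1 / 2 \<and>
             2 * a 1 * (1 - \<alpha> 1) + 2 * a 2 * (1 - \<alpha> 2) \<ge> (a 1 + a 2)\<^sup>2))"
proof -
  have sum3: "(\<Sum>i=1..3. g i) = g 1 + g 2 + g 3" for g :: "nat \<Rightarrow> real"
    by (simp add: numeral_3_eq_3 numeral_2_eq_2)
  define t where "t i = 1 - \<alpha> i" for i
  have 3: "1 \<in> {1..3::nat}" "2 \<in> {1..3::nat}" "3 \<in> {1..3::nat}"
    by auto
  have t: "0 < t 1" "t 1 < t 2" "t 2 < t 3" "t 3 < 1"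
    using assms(3)[rule_format, OF 3(1)] assms(3)[rule_format, OF 3(3)] assms(5,6)
    by (auto simp: t_def)
  have a: "0 < a 1" "0 < a 2" "0 < a 3"
    using assms(2)[rule_format, OF 3(1)] assms(2)[rule_format, OF 3(2)]
      assms(2)[rule_format, OF 3(3)] by auto
  have point: "\<alpha> i * x + (1 - \<alpha> i) * y = x + t i * (y - x)" for i
    by (simp add: t_def algebra_simps)
  have order: "(\<forall>f. convex_on {x..y} f \<longrightarrow>
            (\<Sum>i=1..3. a i * f (x + t i * (y - x))) \<le> 1 / (y - x) * integral {x..y} f) \<longleftrightarrow>
         (\<Sum>i=1..3. a i * t i) = 1 / 2 \<and>
         (\<forall>s\<in>{0..1}. (\<Sum>i=1..3. a i * max 0 (s - t i)) \<le> s\<^sup>2 / 2)"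
  proof (rule scaled_atoms_below_uniform_iff[OF assms(1)])
    show "(\<Sum>i=1..3. a i) = 1"
      using assms(4) unfolding sum3 .
    show "t i \<in> {0<..<1}" if "i \<in> {1..3}" for i
      using assms(3)[rule_format, OF that] by (auto simp: t_def)
  qed auto
  \<comment> \<open>The mean condition lets the second vertex value be expressed through the third node alone,
     which is the form used when only that vertex matters.\<close>
  have third_node: "2 * \<alpha> 3 \<ge> a 3 \<longleftrightarrow> (a 1 + a 2)\<^sup>2 \<le> 2 * a 1 * t 1 + 2 * a 2 * t 2"
    if mean: "a 1 * t 1 + a 2 * t 2 + a 3 * t 3 = 1 / 2"
  proof -
    have "a 1 + a 2 = 1 - a 3"
      using assms(4) by simp
    moreover have "2 * a 1 * t 1 + 2 * a 2 * t 2 = 1 - 2 * a 3 * t 3"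
      using mean by simp
    ultimately have "2 * a 1 * t 1 + 2 * a 2 * t 2 - (a 1 + a 2)\<^sup>2 = a 3 * (2 * (1 - t 3) - a 3)"
      by (simp only:) (simp add: power2_eq_square algebra_simps)
    then have "(a 1 + a 2)\<^sup>2 \<le> 2 * a 1 * t 1 + 2 * a 2 * t 2 \<longleftrightarrow> 0 \<le> a 3 * (2 * (1 - t 3) - a 3)"
      by linarith
    then show ?thesis
      using a(3) by (simp add: zero_le_mult_iff t_def)
  qed
  show ?thesis
    unfolding point order unfolding t_def[symmetric] sum3
  proof (intro conj_cong refl, goal_cases)
    case 1
    have first_node: "t 1 \<ge> a 1 / 2 \<longleftrightarrow> a 1 \<le> 2 * t 1"
      by auto
    show ?case
      unfolding three_hinges_below_parabola_iff[OF t a(1,2) assms(4) 1] first_node third_node[OF 1]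
      using t a by (intro vertex_conditions_iff_alternatives) auto
  qed
qed

end
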